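(* For integers $d\ge1$, $q\ge2$ let $\delta=\lfloor d/2\rfloor$, $\delta'=\lceil d/2\rceil$, and for $\alpha\in[0,1)$ define \[ A^{\mathrm{SRW}}_{\alpha, d, q} = 2(1-\alpha)(q+1 - q^{1-\delta'} - q^{-\delta}) \tfrac{q-1}{(q+1)^2},\quad A^{\mathrm{sphere}}_{d,q}=A^{\mathrm{ball}}_{d,q} = \tfrac{2(q+1-q^{1-\delta'} - q^{-\delta})}{q+1}, \] \[ B^{\mathrm{SRW}}_{\alpha, d, q} = d + \tfrac{2(\delta q^{-\delta} + \delta' q^{1-\delta'})}{q+1} + \tfrac{2(q^{1-\delta} - q^{1-\delta'})}{(q+1)^2}, \] \[ B^{\mathrm{sphere}}_{d,q} = d + \tfrac{-4q+2(\delta'(q-1)+1)q^{1-\delta'} + 2(\delta(q-1)+q) q^{-\delta}}{q^2-1},\quad B^{\mathrm{ball}}_{d,q} = d + \tfrac{-6q-2+2(\delta'(q-1)+2)q^{1-\delta'} + 2(\delta(q-1)+q+1)q^{-\delta}}{q^2-1}. \] Then for all $\alpha\in[0,1)$, $d\in\mathbb{Z}_{\ge1}$, $q\in\mathbb{Z}_{\ge2}$, \[ 0 < A^{\mathrm{SRW}}_{\alpha, d, q} < A^{\mathrm{sphere}}_{d,q} = A^{\mathrm{ball}}_{d,q} < 2,\qquad B^{\mathrm{SRW}}_{\alpha, d, q} > B^{\mathrm{sphere}}_{d,q} > B^{\mathrm{ball}}_{d,q} \ge \tfrac{1}{3}, \] and $B^{\mathrm{ball}}_{d,q} = \frac13$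 if and only if $(d,q)=(1,2)$. *)

theory Defs
  imports Complex_Main
begin

definition dlo :: "int \<Rightarrow> int" where
  "dlo d = \<lfloor>real_of_int d / 2\<rfloor>"

definition dhi :: "int \<Rightarrow> int" where
  "dhi d = \<lceil>real_of_int d / 2\<rceil>"

text \<open>The exponents \<open>1 - dhi d\<close> and \<open>- dlo d\<close> may be negative, hence \<open>powi\<close>.\<close>

definition A_SRW :: "real \<Rightarrow> int \<Rightarrow> int \<Rightarrow> real" where
  "A_SRW \<alpha> d q =
     2 * (1 - \<alpha>) *
     (real_of_int q + 1 - real_of_int q powi (1 - dhi d) - real_of_int q powi (- dlo d)) *
     ((real_of_int q - 1) / (real_of_int q + 1)^2)"

definition A_sphere :: "int \<Rightarrow> int \<Rightarrow> real" where
  "A_sphere d q =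
     2 * (real_of_int q + 1 - real_of_int q powi (1 - dhi d) - real_of_int q powi (- dlo d)) /
     (real_of_int q + 1)"

definition A_ball :: "int \<Rightarrow> int \<Rightarrow> real" where
  "A_ball d q =
     2 * (real_of_int q + 1 - real_of_int q powi (1 - dhi d) - real_of_int q powi (- dlo d)) /
     (real_of_int q + 1)"

text \<open>The right-hand side does not depend on \<open>\<alpha>\<close>; the argument is kept to match the
  indexing of the constant.\<close>

definition B_SRW :: "real \<Rightarrow> int \<Rightarrow> int \<Rightarrow> real" where
  "B_SRW \<alpha> d q =
     real_of_int d +
     2 * (real_of_int (dlo d) * real_of_int q powi (- dlo d) +
          real_of_int (dhi d) * real_of_int q powi (1 - dhi d)) / (real_of_int q + 1) +
     2 * (real_of_int q powi (1 - dlo d) - real_of_int q powi (1 - dhi d)) /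
       (real_of_int q + 1)^2"

definition B_sphere :: "int \<Rightarrow> int \<Rightarrow> real" where
  "B_sphere d q =
     real_of_int d +
     (- 4 * real_of_int q
      + 2 * (real_of_int (dhi d) * (real_of_int q - 1) + 1) * real_of_int q powi (1 - dhi d)
      + 2 * (real_of_int (dlo d) * (real_of_int q - 1) + real_of_int q) *
          real_of_int q powi (- dlo d)) /
     ((real_of_int q)^2 - 1)"

definition B_ball :: "int \<Rightarrow> int \<Rightarrow> real" where
  "B_ball d q =
     real_of_int d +
     (- 6 * real_of_int q - 2
      + 2 * (real_of_int (dhi d) * (real_of_int q - 1) + 2) * real_of_int q powi (1 - dhi d)
      + 2 * (real_of_int (dlo d) * (real_of_int q - 1) + real_of_int q + 1) *
          real_of_int q powi (- dlo d)) /
     ((real_of_int q)^2 - 1)"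

end

theory Submission
  imports Defs
begin

text \<open>With \<open>n = \<lfloor>d/2\<rfloor>\<close> and \<open>x = q^(-n)\<close>, all constants become rational functions of
  \<open>n\<close>, \<open>q\<close>, \<open>x\<close>, one family for each parity of \<open>d\<close>; every comparison except the lower bound on
  \<open>B_ball\<close> only uses \<open>0 < x \<le> 1\<close> (and \<open>x < 1\<close> for even \<open>d\<close>).  In the lower bound, the subtracted term is at most
  \<open>(6q+2)/(q^2-1) \<le> 14/3\<close>, which suffices for \<open>d \<ge> 5\<close>; for \<open>d \<le> 4\<close> the values are
  \<open>1 - 2/(q+1)\<close>, \<open>2(q-1)/(q+1)\<close>, \<open>3 - 6/(q+1)\<close> and \<open>2(2q-1)(q-1)/q^2\<close>.\<close>

lemma dlo_dhi_even:
  "dlo (2 * int n) = int n" "dhi (2 * int n) = int n"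
  by (simp_all add: dlo_def dhi_def)

lemma dlo_dhi_odd:
  "dlo (2 * int n + 1) = int n" "dhi (2 * int n + 1) = int n + 1"
  by (simp_all add: dlo_def dhi_def floor_eq_iff ceiling_eq_iff)

lemma powi_minus_nat_bounds:
  fixes Q :: real
  assumes "Q \<ge> 1"
  shows "0 < Q powi (- int n)" "Q powi (- int n) \<le> 1"
  using assms by (simp_all add: power_int_minus inverse_le_1_iff)

lemma powi_one_minus:
  fixes Q :: real
  assumes "Q \<noteq> 0"
  shows "Q powi (1 - k) = Q * Q powi (- k)"
  using assms power_int_add[of Q 1 "- k"] by simp

text \<open>Both halves of \<open>d\<close> equal \<open>n\<close>, so the last fraction of
  \<open>B_SRW\<close> vanishes and the factor \<open>Q + 1\<close> cancels in the first. All three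
  constants share \<open>2 * n + 2 * n * x\<close>; they differ only in a multiple of
  \<open>1 - x\<close>.\<close>

lemma B_even:
  fixes q :: int and n :: nat and Q x :: real
  assumes "q \<ge> 2"
  defines "Q \<equiv> real_of_int q" and "x \<equiv> real_of_int q powi (- int n)"
  shows "B_SRW \<alpha> (2 * int n) q = 2 * real n + 2 * real n * x"
    and "B_sphere (2 * int n) q = 2 * real n + 2 * real n * x - 4 * Q * (1 - x) / (Q\<^sup>2 - 1)"
    and "B_ball (2 * int n) q = 2 * real n + 2 * real n * x - (6 * Q + 2) * (1 - x) / (Q\<^sup>2 - 1)"
proof -
  have Q: "Q \<ge> 2" using assms by simp
  have nz: "Q + 1 \<noteq> 0" "Q\<^sup>2 - 1 \<noteq> 0"
    using Q power_mono[of 2 Q 2] by auto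
  have px: "Q powi (1 - int n) = Q * x" "Q powi (- int n) = x"
    using Q powi_one_minus[of Q "int n"] unfolding x_def Q_def by auto
  show "B_SRW \<alpha> (2 * int n) q = 2 * real n + 2 * real n * x"
    unfolding B_SRW_def dlo_dhi_even Q_def[symmetric] px
    using nz by (simp add: divide_simps) (simp add: algebra_simps)
  show "B_sphere (2 * int n) q = 2 * real n + 2 * real n * x - 4 * Q * (1 - x) / (Q\<^sup>2 - 1)"
    unfolding B_sphere_def dlo_dhi_even Q_def[symmetric] px
    using nz by (simp add: divide_simps) (simp add: algebra_simps power2_eq_square)
  show "B_ball (2 * int n) q = 2 * real n + 2 * real n * x - (6 * Q + 2) * (1 - x) / (Q\<^sup>2 - 1)"
    unfolding B_ball_def dlo_dhi_even Q_def[symmetric] px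
    using nz by (simp add: divide_simps) (simp add: algebra_simps power2_eq_square)
qed

text \<open>Here \<open>1 - dhi d = - dlo d = - n\<close>, so both powers equal \<open>x\<close> and
  their coefficients \<open>n\<close> and \<open>n + 1\<close> add up to \<open>2 * n + 1\<close>.
  \<open>C\<close> is the part common to the three constants.\<close>

lemma B_odd:
  fixes q :: int and n :: nat and Q x C :: real
  assumes "q \<ge> 2"
  defines "Q \<equiv> real_of_int q" and "x \<equiv> real_of_int q powi (- int n)"
  defines "C \<equiv> 2 * real n + 1 + 2 * (2 * real n + 1) * x / (Q + 1)"
  shows "B_SRW \<alpha> (2 * int n + 1) q = C + 2 * (Q - 1) * x / (Q + 1)\<^sup>2"
    and "B_sphere (2 * int n + 1) q = C - (4 * Q - 2 * (Q + 1) * x) / (Q\<^sup>2 - 1)"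
    and "B_ball (2 * int n + 1) q = C - (6 * Q + 2 - (2 * Q + 6) * x) / (Q\<^sup>2 - 1)"
proof -
  have Q: "Q \<ge> 2" using assms by simp
  have nz: "Q + 1 \<noteq> 0" "Q - 1 \<noteq> 0"
    using Q by auto
  have sq: "Q\<^sup>2 - 1 = (Q + 1) * (Q - 1)"
    by (simp add: algebra_simps power2_eq_square)
  have px: "Q powi (1 - int n) = Q * x" "Q powi (- int n) = x" "Q powi (1 - (int n + 1)) = x"
    using Q powi_one_minus[of Q "int n"] unfolding x_def Q_def by auto
  show "B_SRW \<alpha> (2 * int n + 1) q = C + 2 * (Q - 1) * x / (Q + 1)\<^sup>2"
    unfolding B_SRW_def dlo_dhi_odd Q_def[symmetric] px C_def
    by (simp add: algebra_simps)
  show "B_sphere (2 * int n + 1) q = C - (4 * Q - 2 * (Q + 1) * x) / (Q\<^sup>2 - 1)"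
    unfolding B_sphere_def dlo_dhi_odd Q_def[symmetric] px C_def sq
    using nz by (simp add: divide_simps) (simp add: algebra_simps)
  show "B_ball (2 * int n + 1) q = C - (6 * Q + 2 - (2 * Q + 6) * x) / (Q\<^sup>2 - 1)"
    unfolding B_ball_def dlo_dhi_odd Q_def[symmetric] px C_def sq
    using nz by (simp add: divide_simps) (simp add: algebra_simps)
qed

lemma ball_loss_le:
  fixes Q :: real
  assumes "Q \<ge> 2"
  shows "(6 * Q + 2) / (Q\<^sup>2 - 1) \<le> 14 / 3"
proof -
  \<comment> \<open>Equality holds at \<open>Q = 2\<close>, so \<open>Q - 2\<close> divides the
    difference left after clearing denominators.\<close>
  have "0 \<le> (Q - 2) * (14 * Q + 10)" using assms by simp
  then have "3 * (6 * Q + 2) \<le> 14 * (Q\<^sup>2 - 1)"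
    by (simp add: algebra_simps power2_eq_square)
  moreover have "Q\<^sup>2 - 1 > 0" using assms power_mono[of 2 Q 2] by simp
  ultimately show ?thesis by (simp add: divide_simps)
qed

text \<open>At \<open>n = 0\<close> all three constants are 0. For \<open>n \<ge> 1\<close> one has
  \<open>x < 1\<close>, and the first two comparisons reduce to
  \<open>0 < 4 * Q < 6 * Q + 2\<close>.\<close>

lemma B_even_bounds:
  fixes q :: int and n :: nat
  assumes "q \<ge> 2" "n \<ge> 1"
  shows "B_SRW \<alpha> (2 * int n) q > B_sphere (2 * int n) q"
    and "B_sphere (2 * int n) q > B_ball (2 * int n) q"
    and "B_ball (2 * int n) q > 1 / 3"
proof -
  define Q where "Q = real_of_int q"
  define x where "x = Q powi (- int n)"
  have Q: "Q \<ge> 2" using assms by (simp add: Q_def)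
  have sq: "Q\<^sup>2 - 1 > 0" using Q power_mono[of 2 Q 2] by simp
  have x0: "x > 0" using Q powi_minus_nat_bounds[of Q n] by (simp add: x_def)
  have "Q ^ n > 1" using Q assms by simp
  then have x1: "x < 1"
    by (simp add: x_def power_int_minus inverse_less_1_iff)
  note B = B_even[OF assms(1), where n = n, folded Q_def, folded x_def]
  show "B_SRW \<alpha> (2 * int n) q > B_sphere (2 * int n) q"
    unfolding B using Q x1 sq by simp
  show "B_sphere (2 * int n) q > B_ball (2 * int n) q"
    unfolding B using Q x1 sq by (simp add: divide_strict_right_mono)
  show "B_ball (2 * int n) q > 1 / 3"
  proof -
    consider "n = 1" | "n = 2" | "n \<ge> 3" using assms(2) by linarith
    then show ?thesis
    proof cases
      case 1
      then have x: "x = 1 / Q" by (simp add: x_def power_int_minus divide_inverse)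
      have "B_ball (2 * int n) q = 2 * (Q - 1) / (Q + 1)"
      proof -
        have f: "Q\<^sup>2 - 1 = (Q + 1) * (Q - 1)"
          by (simp add: algebra_simps power2_eq_square)
        show ?thesis unfolding B x f using Q 1
          by (simp add: divide_simps) (simp add: algebra_simps)
      qed
      moreover have "2 * (Q - 1) / (Q + 1) > 1 / 3" using Q by (simp add: divide_simps)
      ultimately show ?thesis by simp
    next
      case 2
      then have x: "x = 1 / Q\<^sup>2" by (simp add: x_def power_int_minus divide_inverse)
      have eq: "B_ball (2 * int n) q = 2 * ((2 * Q - 1) * (Q - 1)) / Q\<^sup>2"
      proof -
        \<comment> \<open>Since \<open>1 - x = (Q\<^sup>2 - 1) / Q\<^sup>2\<close>, the denominator
          cancels.\<close>
        have loss: "(6 * Q + 2) * (1 - x) / (Q\<^sup>2 - 1) = (6 * Q + 2) / Q\<^sup>2"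
          unfolding x using Q sq by (simp add: field_simps)
        show ?thesis unfolding B loss unfolding x using Q 2
          by (simp add: divide_simps) (simp add: algebra_simps power2_eq_square)
      qed
      have "6 * ((2 * Q - 1) * (Q - 1)) > Q\<^sup>2"
      proof -
        \<comment> \<open>Division with remainder by \<open>Q - 2\<close>; 14 is the value at
          \<open>Q = 2\<close>.\<close>
        have "6 * ((2 * Q - 1) * (Q - 1)) - Q\<^sup>2 = (Q - 2) * (11 * Q + 4) + 14"
          by (simp add: algebra_simps power2_eq_square)
        moreover have "(Q - 2) * (11 * Q + 4) \<ge> 0" using Q by simp
        ultimately show ?thesis by linarith
      qed
      then have "2 * ((2 * Q - 1) * (Q - 1)) / Q\<^sup>2 > 1 / 3" using Q by (simp add: divide_simps)
      then show ?thesis unfolding eq .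
    next
      case 3
      have "(6 * Q + 2) * (1 - x) / (Q\<^sup>2 - 1) \<le> (6 * Q + 2) / (Q\<^sup>2 - 1)"
        using Q x0 sq by (intro divide_right_mono) auto
      also have "\<dots> \<le> 14 / 3" by (rule ball_loss_le[OF Q])
      finally have "(6 * Q + 2) * (1 - x) / (Q\<^sup>2 - 1) \<le> 14 / 3" .
      moreover have "2 * real n * x \<ge> 0" using x0 by simp
      moreover have "2 * real n \<ge> 6" using 3 by simp
      ultimately show ?thesis unfolding B by linarith
    qed
  qed
qed

text \<open>This is the case \<open>n = 0\<close>, \<open>x = 1\<close>: the subtracted term becomes
  \<open>4 / (Q + 1)\<close>, while \<open>C\<close> contributes \<open>1 + 2 / (Q + 1)\<close>. The
  result increases with \<open>q\<close> and equals 1/3 at \<open>q = 2\<close>, the source of the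
  equality case.\<close>

lemma B_ball_1:
  assumes "q \<ge> 2"
  shows "B_ball 1 q = 1 - 2 / (real_of_int q + 1)"
proof -
  have f: "(real_of_int q)\<^sup>2 - 1 = (real_of_int q + 1) * (real_of_int q - 1)"
    by (simp add: algebra_simps power2_eq_square)
  define Q where "Q = real_of_int q"
  have "Q \<ge> 2" using assms by (simp add: Q_def)
  then have "2 / (Q + 1) - (4 * Q - 4) / ((Q + 1) * (Q - 1)) = - (2 / (Q + 1))"
    by (simp add: divide_simps)
  then show ?thesis
    using B_odd(3)[OF assms, of 0] unfolding f Q_def by simp
qed

lemma B_ball_odd_gt:
  fixes q :: int and n :: nat
  assumes "q \<ge> 2" "n \<ge> 1"
  shows "B_ball (2 * int n + 1) q > 1 / 3"
proof -
  define Q where "Q = real_of_int q"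
  define x where "x = Q powi (- int n)"
  have Q: "Q \<ge> 2" using assms by (simp add: Q_def)
  have sq: "Q\<^sup>2 - 1 > 0" using Q power_mono[of 2 Q 2] by simp
  have x0: "x > 0" using Q powi_minus_nat_bounds[of Q n] by (simp add: x_def)
  note B = B_odd(3)[OF assms(1), of n, folded Q_def, folded x_def]
  show ?thesis
  proof (cases "n = 1")
    case True
    then have x: "x = 1 / Q" by (simp add: x_def power_int_minus divide_inverse)
    have loss: "(6 * Q + 2 - (2 * Q + 6) * x) / (Q\<^sup>2 - 1) = 6 / Q"
    proof -
      \<comment> \<open>At \<open>x = 1 / Q\<close> the constants 2 and -2 cancel, leaving
        \<open>6 * Q - 6 / Q\<close>.\<close>
      have "6 * Q + 2 - (2 * Q + 6) * x = 6 / Q * (Q\<^sup>2 - 1)"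
        unfolding x using Q by (simp add: field_simps power2_eq_square)
      then show ?thesis using sq by (simp only: nonzero_mult_div_cancel_right)
    qed
    have "B_ball (2 * int n + 1) q = 3 - 6 / (Q + 1)"
      unfolding B loss unfolding x using Q True by (simp add: divide_simps) (simp add: algebra_simps)
    moreover have "3 - 6 / (Q + 1) > 1 / 3" using Q by (simp add: divide_simps)
    ultimately show ?thesis by simp
  next
    case False
    have "(6 * Q + 2 - (2 * Q + 6) * x) / (Q\<^sup>2 - 1) \<le> (6 * Q + 2) / (Q\<^sup>2 - 1)"
      using Q x0 sq by (intro divide_right_mono) auto
    also have "\<dots> \<le> 14 / 3" by (rule ball_loss_le[OF Q])
    finally have "(6 * Q + 2 - (2 * Q + 6) * x) / (Q\<^sup>2 - 1) \<le> 14 / 3" .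
    \<comment> \<open>For \<open>n = 2\<close> the estimate is tight,
      \<open>5 - 14 / 3 = 1 / 3\<close>, so strictness has to come from this positive term.\<close>
    moreover have "2 * (2 * real n + 1) * x / (Q + 1) > 0" using x0 Q by simp
    moreover have "2 * real n + 1 \<ge> 5" using False assms(2) by simp
    ultimately show ?thesis unfolding B by linarith
  qed
qed

text \<open>Unlike in the even case, \<open>x \<le> 1\<close> gives strict inequalities, so
  \<open>n = 0\<close> is covered: the sphere numerator is at least \<open>2 * Q - 2 > 0\<close>,
  and the ball numerator exceeds it by \<open>2 * Q + 2 - 4 * x > 0\<close>.\<close>

lemma B_odd_bounds:
  fixes q :: int and n :: nat
  assumes "q \<ge> 2"
  shows "B_SRW \<alpha> (2 * int n + 1) q > B_sphere (2 * int n + 1) q"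
    and "B_sphere (2 * int n + 1) q > B_ball (2 * int n + 1) q"
proof -
  define Q where "Q = real_of_int q"
  define x where "x = Q powi (- int n)"
  have Q: "Q \<ge> 2" using assms by (simp add: Q_def)
  have sq: "Q\<^sup>2 - 1 > 0" using Q power_mono[of 2 Q 2] by simp
  have x: "x > 0" "x \<le> 1" using Q powi_minus_nat_bounds[of Q n] by (simp_all add: x_def)
  note B = B_odd[OF assms(1), where n = n, folded Q_def, folded x_def]
  have "(Q + 1) * x \<le> Q + 1" using x Q by (simp add: mult_left_le)
  then have "4 * Q - 2 * (Q + 1) * x > 0" using Q by linarith
  then have "(4 * Q - 2 * (Q + 1) * x) / (Q\<^sup>2 - 1) > 0" using sq by simp
  moreover have "2 * (Q - 1) * x / (Q + 1)\<^sup>2 \<ge> 0" using Q x by simp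
  ultimately show "B_SRW \<alpha> (2 * int n + 1) q > B_sphere (2 * int n + 1) q"
    unfolding B by linarith
  have "6 * Q + 2 - (2 * Q + 6) * x - (4 * Q - 2 * (Q + 1) * x) = 2 * Q + 2 - 4 * x"
    by (simp add: algebra_simps)
  then have "4 * Q - 2 * (Q + 1) * x < 6 * Q + 2 - (2 * Q + 6) * x" using Q x by linarith
  then show "B_sphere (2 * int n + 1) q > B_ball (2 * int n + 1) q"
    unfolding B using sq by (simp add: divide_strict_right_mono)
qed

text \<open>\<open>A_SRW\<close> is \<open>A_sphere\<close> times a factor strictly between 0 and 1,
  and the common bracket \<open>S\<close> lies strictly between 0 and \<open>Q + 1\<close>.\<close>

lemma A_bounds:
  assumes "0 \<le> \<alpha>" "\<alpha> < 1" "d \<ge> 1" "q \<ge> 2"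
  shows "0 < A_SRW \<alpha> d q" "A_SRW \<alpha> d q < A_sphere d q" "A_ball d q < 2"
proof -
  define Q where "Q = real_of_int q"
  have Q: "Q \<ge> 2" using assms by (simp add: Q_def)
  define y where "y = Q powi (1 - dhi d)"
  define z where "z = Q powi (- dlo d)"
  \<comment> \<open>Both exponents are thus negated naturals, which puts \<open>y\<close> and
    \<open>z\<close> in (0, 1].\<close>
  have "dhi d \<ge> 1" "dlo d \<ge> 0" using assms unfolding dhi_def dlo_def by linarith+
  then have "y = Q powi (- int (nat (dhi d - 1)))" "z = Q powi (- int (nat (dlo d)))"
    by (simp_all add: y_def z_def)
  then have yz: "0 < y" "y \<le> 1" "0 < z" "z \<le> 1"
    using Q powi_minus_nat_bounds[of Q] by (simp_all only:)
  define S where "S = Q + 1 - y - z"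
  have S: "S > 0" "S < Q + 1" using Q yz by (simp_all add: S_def)
  have sph: "A_sphere d q = 2 * S / (Q + 1)" and ball: "A_ball d q = 2 * S / (Q + 1)"
    by (simp_all add: A_sphere_def A_ball_def S_def y_def z_def Q_def)
  have srw: "A_SRW \<alpha> d q = A_sphere d q * ((1 - \<alpha>) * ((Q - 1) / (Q + 1)))"
    unfolding sph A_SRW_def Q_def[symmetric] y_def[symmetric] z_def[symmetric] S_def[symmetric]
    by (simp add: power2_eq_square)
  have pos: "A_sphere d q > 0" unfolding sph using S Q by simp
  have r: "0 < (Q - 1) / (Q + 1)" "(Q - 1) / (Q + 1) < 1" using Q by simp_all
  show "0 < A_SRW \<alpha> d q" unfolding srw using pos r assms by (intro mult_pos_pos) simp_all
  have "(1 - \<alpha>) * ((Q - 1) / (Q + 1)) \<le> (Q - 1) / (Q + 1)"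
    using r(1) assms by (intro mult_left_le_one_le) auto
  then have "(1 - \<alpha>) * ((Q - 1) / (Q + 1)) < 1" using r(2) by linarith
  from mult_strict_left_mono[OF this pos] show "A_SRW \<alpha> d q < A_sphere d q"
    by (simp only: srw mult_1_right)
  show "A_ball d q < 2" unfolding ball using S Q by (simp add: divide_simps)
qed

theorem theorem9p2:
  fixes \<alpha> :: real and d q :: int
  assumes "0 \<le> \<alpha>" and "\<alpha> < 1" and "d \<ge> 1" and "q \<ge> 2"
  shows "0 < A_SRW \<alpha> d q \<and> A_SRW \<alpha> d q < A_sphere d q \<and>
         A_sphere d q = A_ball d q \<and> A_ball d q < 2 \<and>
         B_SRW \<alpha> d q > B_sphere d q \<and> B_sphere d q > B_ball d q \<and> B_ball d q \<ge> 1 / 3 \<and>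
         (B_ball d q = 1 / 3 \<longleftrightarrow> (d, q) = (1, 2))"
proof -
  define n where "n = nat (d div 2)"
  have AA: "A_sphere d q = A_ball d q" by (simp add: A_sphere_def A_ball_def)
  \<comment> \<open>\<open>d = 1\<close> is split off as the only case where 1/3 can be attained;
    elsewhere the lower bound is strict and both sides of the equivalence are false.\<close>
  consider (even) "d = 2 * int n" "n \<ge> 1" | (one) "d = 1" | (odd) "d = 2 * int n + 1" "n \<ge> 1"
    using assms(3) unfolding n_def by linarith
  then have "B_SRW \<alpha> d q > B_sphere d q \<and> B_sphere d q > B_ball d q \<and> B_ball d q \<ge> 1 / 3 \<and>
         (B_ball d q = 1 / 3 \<longleftrightarrow> (d, q) = (1, 2))"
  proof cases
    case even
    then have "d \<noteq> 1" by presburger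
    then show ?thesis
      using B_even_bounds[OF assms(4) even(2)] even(1) by auto
  next
    case one
    have "B_ball 1 q \<ge> 1 / 3" "B_ball 1 q = 1 / 3 \<longleftrightarrow> q = 2"
      unfolding B_ball_1[OF assms(4)] using assms(4) by (auto simp: divide_simps)
    then show ?thesis using B_odd_bounds[OF assms(4), where n = 0] one by simp
  next
    case odd
    then have "d \<noteq> 1" by presburger
    then show ?thesis
      using B_odd_bounds[OF assms(4), where n = n] B_ball_odd_gt[OF assms(4) odd(2)] odd(1) by auto
  qed
  with A_bounds[OF assms] AA show ?thesis by blast
qed

end
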